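(* Let $\mathcal P$ be a smallness property of groups. If a group $G$ contains a normal subgroup $N$ satisfying an outer commutator identity $w(x_1,\dots,x_t)=1$ and $G/N$ has the property $\mathcal P$, then $G$ contains a characteristic, and even invariant under all surjective endomorphisms of $G$, subgroup $H$ satisfying the same identity and such that $G/H$ has the property $\mathcal P$.
   Context: Outer commutators: let $F(x_1,x_2,\dots)$ be a free group of countable rank. An outer commutator of weight $1$ is a letter $x_i$. An outer commutator of weight $t>1$ is a word of the form $w(x_1,\dots,x_t)=[u(x_1,\dots,x_r),v(x_{r+1},\dots,x_t)]$, where $u$ and $v$ are outer commutators of weights $r$ and $t-r$, respectively (so all letters occurring are different). An outer commutator identity is an identity $w=1$ with $w$ an outer commutator. A smallness property is any abstract (i.e. isomorphism-invariant) group property $\mathcal P$ such that: (1) any quotient group of a group with property $\mathcal P$ also has this property; (2) a subdirect product of two groups with property $\mathcal P$ also has this property; (3) each group with property $\mathcal P$ satisfies the maximality condition (ACC) for normal subgroups. *)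

theory Defs
  imports "HOL-Algebra.Coset"
begin

section \<open>Outer commutators\<close>

text \<open>
  An element of the free group on the letters \<open>x\<^sub>0, x\<^sub>1, \<dots>\<close> is written as a list of signed letters:
  \<open>(i, True)\<close> is \<open>x\<^sub>i\<close> and \<open>(i, False)\<close> is its inverse. No reduction step is needed for the words
  used here: by lemma \<open>outer_commutator_reduced\<close> below, disjointness of the letters makes every
  outer commutator a reduced word, that is, the normal form of an element of the free group.
\<close>

type_synonym group_word = "(nat \<times> bool) list"

definition word_inv :: "group_word \<Rightarrow> group_word" where
  "word_inv w = rev (map (\<lambda>(i, b). (i, \<not> b)) w)"

text \<open>The convention is \<open>[u, v] = u\<^sup>-\<^sup>1 v\<^sup>-\<^sup>1 u v\<close>.\<close>

definition word_commutator :: "group_word \<Rightarrow> group_word \<Rightarrow> group_word" where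
  "word_commutator u v = word_inv u @ word_inv v @ u @ v"

definition letters :: "group_word \<Rightarrow> nat set" where
  "letters w = fst ` set w"

inductive outer_commutator :: "nat \<Rightarrow> group_word \<Rightarrow> bool" where
  letter: "outer_commutator 1 [(i, True)]"
| commutator: "\<lbrakk>outer_commutator r u; outer_commutator s v; letters u \<inter> letters v = {}\<rbrakk>
    \<Longrightarrow> outer_commutator (r + s) (word_commutator u v)"

definition reduced_word :: "group_word \<Rightarrow> bool" where
  "reduced_word = successively (\<lambda>(i, b) (j, c). \<not> (i = j \<and> b \<noteq> c))"

definition word_eval :: "('a, 'b) monoid_scheme \<Rightarrow> (nat \<Rightarrow> 'a) \<Rightarrow> group_word \<Rightarrow> 'a" where
  "word_eval K \<sigma> w =
     foldr (\<lambda>(i, b) y. (if b then \<sigma> i else inv\<^bsub>K\<^esub> \<sigma> i) \<otimes>\<^bsub>K\<^esub> y) w \<one>\<^bsub>K\<^esub>"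

definition satisfies_identity :: "('a, 'b) monoid_scheme \<Rightarrow> group_word \<Rightarrow> bool" where
  "satisfies_identity K w \<longleftrightarrow>
     (\<forall>\<sigma>. (\<forall>i. \<sigma> i \<in> carrier K) \<longrightarrow> word_eval K \<sigma> w = \<one>\<^bsub>K\<^esub>)"

lemma letters_word_inv [simp]: "letters (word_inv w) = letters w"
  by (force simp: letters_def word_inv_def)

lemma reduced_word_inv: "reduced_word w \<Longrightarrow> reduced_word (word_inv w)"
  unfolding reduced_word_def word_inv_def
  by (auto simp: successively_rev successively_map elim!: successively_mono)

lemma reduced_word_append:
  "\<lbrakk>reduced_word u; reduced_word v; u \<noteq> [] \<Longrightarrow> v \<noteq> [] \<Longrightarrow> fst (last u) \<noteq> fst (hd v)\<rbrakk>
    \<Longrightarrow> reduced_word (u @ v)"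
  unfolding reduced_word_def by (auto simp: successively_append_iff split: prod.splits)

lemma letters_hd_last: "u \<noteq> [] \<Longrightarrow> fst (hd u) \<in> letters u \<and> fst (last u) \<in> letters u"
  unfolding letters_def by auto

lemma outer_commutator_reduced: "outer_commutator t w \<Longrightarrow> w \<noteq> [] \<and> reduced_word w"
proof (induction rule: outer_commutator.induct)
  case (letter i)
  then show ?case by (simp add: reduced_word_def)
next
  case (commutator r u s v)
  have ne: "word_inv u \<noteq> []" "word_inv v \<noteq> []"
    using commutator by (auto simp: word_inv_def)
  have vu: "letters v \<inter> letters u = {}"
    using commutator by (simp add: Int_commute)
  have disj: "fst (last a) \<noteq> fst (hd b)"
    if "a \<noteq> []" "b \<noteq> []" "letters a \<inter> letters b = {}" for a b :: group_word
    using letters_hd_last[OF that(1)] letters_hd_last[OF that(2)] that(3) by (metis disjoint_iff)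
  have uv: "reduced_word (u @ v)"
    using commutator disj[of u v] by (intro reduced_word_append) auto
  have iuv: "reduced_word (word_inv v @ u @ v)"
    using commutator uv ne vu disj[of "word_inv v" u]
    by (intro reduced_word_append[of "word_inv v"] reduced_word_inv) auto
  have "reduced_word (word_inv u @ word_inv v @ u @ v)"
    using commutator iuv ne disj[of "word_inv u" "word_inv v"]
    by (intro reduced_word_append[of "word_inv u"] reduced_word_inv) auto
  then show ?case using ne by (simp add: word_commutator_def)
qed

section \<open>Smallness properties\<close>

text \<open>
  A group property applies to groups over different types (\<open>G Mod N\<close> and \<open>K \<times>\<times> L\<close> do not live
  over the types of \<open>G\<close>, \<open>K\<close> and \<open>L\<close>), whereas a HOL predicate is tied to one type. An abstract
  property is therefore given by a predicate \<open>P\<close> on the groups over a type \<open>'u\<close>, which plays the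
  role of a universe, and a group over any type has the property iff it is isomorphic to a group
  over \<open>'u\<close> satisfying \<open>P\<close>. As \<open>'u\<close> is arbitrary, nothing is lost: an arbitrary abstract property
  is represented faithfully on all groups whose cardinality is at most that of \<open>'u\<close>; for
  infinite \<open>'u\<close> these groups are closed under quotients and subdirect products.
\<close>

definition has_property :: "('u monoid \<Rightarrow> bool) \<Rightarrow> ('a, 'b) monoid_scheme \<Rightarrow> bool" where
  "has_property P K \<longleftrightarrow> (\<exists>L :: 'u monoid. group L \<and> P L \<and> K \<cong> L)"

definition subdirect_product ::
  "('a \<times> 'c) set \<Rightarrow> ('a, 'b) monoid_scheme \<Rightarrow> ('c, 'd) monoid_scheme \<Rightarrow> bool" where
  "subdirect_product S K L \<longleftrightarrow>
     subgroup S (K \<times>\<times> L) \<and> fst ` S = carrier K \<and> snd ` S = carrier L"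

definition max_normal :: "('a, 'b) monoid_scheme \<Rightarrow> bool" where
  "max_normal K \<longleftrightarrow>
     (\<forall>M :: nat \<Rightarrow> 'a set. (\<forall>i. M i \<lhd> K) \<and> (\<forall>i. M i \<subseteq> M (Suc i)) \<longrightarrow>
        (\<exists>n. \<forall>m\<ge>n. M m = M n))"

definition smallness_property :: "('u monoid \<Rightarrow> bool) \<Rightarrow> bool" where
  "smallness_property P \<longleftrightarrow>
     (\<forall>K L. group K \<and> group L \<and> K \<cong> L \<and> P K \<longrightarrow> P L) \<and>
     (\<forall>K M. group K \<and> P K \<and> M \<lhd> K \<longrightarrow> has_property P (K Mod M)) \<and>
     (\<forall>K L S. group K \<and> P K \<and> group L \<and> P L \<and> subdirect_product S K L \<longrightarrow>
        has_property P ((K \<times>\<times> L)\<lparr>carrier := S\<rparr>)) \<and>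
     (\<forall>K. group K \<and> P K \<longrightarrow> max_normal K)"

lemma has_property_iff:
  fixes P :: "'u monoid \<Rightarrow> bool" and K :: "'u monoid"
  assumes "smallness_property P" "group K"
  shows "has_property P K \<longleftrightarrow> P K"
  using assms group.iso_sym[OF assms(2)] iso_refl[of K]
  unfolding smallness_property_def has_property_def by blast

section \<open>Invariant subgroups\<close>

definition characteristic :: "'a set \<Rightarrow> ('a, 'b) monoid_scheme \<Rightarrow> bool" where
  "characteristic H G \<longleftrightarrow> subgroup H G \<and> (\<forall>\<phi> \<in> iso G G. \<phi> ` H = H)"

definition surj_endo_invariant :: "'a set \<Rightarrow> ('a, 'b) monoid_scheme \<Rightarrow> bool" where
  "surj_endo_invariant H G \<longleftrightarrow> subgroup H G \<and> (\<forall>\<phi> \<in> epi G G. \<phi> ` H \<subseteq> H)"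

end

theory Submission
  imports Defs "HOL-Algebra.SndIsomorphismGrp"
begin

text \<open>
  Call a normal subgroup \<open>N\<close> of \<open>G\<close> large if \<open>G/N\<close> has the property. The three axioms of smallness
  say that large subgroups are closed under passing to bigger normal subgroups, to images under
  surjective endomorphisms and to finite intersections, and that every nonempty family of large
  subgroups has a maximal element.

  An outer commutator is additive in each argument: replacing one argument by a product \<open>ab\<close> splits
  the value into a product of two values, one with a conjugate of \<open>a\<close> and one with a conjugate of \<open>b\<close>
  in that place, the other arguments being changed only by conjugation. So if \<open>w\<close> vanishes when its
  \<open>k\<close>-th argument runs over the normal subgroup \<open>M\<close> or over the normal subgroup \<open>L\<close>, and each
  other argument over some normal subgroup, then it also vanishes when the \<open>k\<close>-th argument runs over
  \<open>M <#> L\<close> (\<open>vanishes_on_set_mult\<close>).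

  The arguments are made invariant one by one (\<open>invariant_argument_step\<close>). Suppose that \<open>w\<close>
  vanishes when the arguments in \<open>S\<close> run over an invariant large \<open>H\<close> and the others over a large
  \<open>K\<close>. For another letter \<open>k\<close>, let \<open>\<Q>\<close> be the set of large \<open>M\<close> for which some large \<open>K'\<close>
  makes \<open>w\<close> vanish with the arguments in \<open>S\<close> in \<open>H\<close>, the \<open>k\<close>-th in \<open>M\<close> and the others in \<open>K'\<close>.
  Additivity makes \<open>\<Q>\<close> closed under products, at the price of intersecting the two subgroups \<open>K'\<close>;
  applying a surjective endomorphism \<open>\<phi>\<close> to all arguments shows that \<open>\<Q>\<close> is closed under \<open>\<phi>\<close>,
  since \<open>\<phi>(H) = H\<close>. A maximal element of \<open>\<Q>\<close> is therefore its greatest element, hence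
  invariant, and \<open>H\<close> can be replaced by its intersection with it and \<open>S\<close> by \<open>S \<union> {k}\<close>. Starting from
  \<open>S = {}\<close>, \<open>H = G\<close>, \<open>K = N\<close> one ends with all letters in \<open>S\<close>, where \<open>H\<close> satisfies the identity.

  The equality \<open>\<phi>(H) = H\<close> used here, where invariance gives only one inclusion, is the Hopfian
  property of groups with the maximality condition for normal subgroups
  (\<open>large_epi_invariant_eq\<close>).
\<close>

section \<open>Values of words\<close>

lemma word_eval_Nil [simp]: "word_eval G \<sigma> [] = \<one>\<^bsub>G\<^esub>"
  by (simp add: word_eval_def)

lemma word_eval_Cons [simp]:
  "word_eval G \<sigma> ((i, b) # w) = (if b then \<sigma> i else inv\<^bsub>G\<^esub> \<sigma> i) \<otimes>\<^bsub>G\<^esub> word_eval G \<sigma> w"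
  by (simp add: word_eval_def)

lemma letters_simps [simp]:
  "letters [] = {}"
  "letters ((i, b) # w) = insert i (letters w)"
  "letters (u @ v) = letters u \<union> letters v"
  "letters (word_commutator u v) = letters u \<union> letters v"
proof -
  show *: "letters (u @ v) = letters u \<union> letters v" for u v
    by (auto simp: letters_def)
  show "letters (word_commutator u v) = letters u \<union> letters v"
    by (auto simp: word_commutator_def *)
qed (auto simp: letters_def)

lemma finite_letters: "finite (letters w)"
  by (simp add: letters_def)

lemma word_eval_cong:
  "(\<And>i. i \<in> letters w \<Longrightarrow> \<sigma> i = \<tau> i) \<Longrightarrow> word_eval G \<sigma> w = word_eval G \<tau> w"
  by (induction w) auto

context group
begin

lemma word_eval_closed [simp]:
  "(\<And>i. \<sigma> i \<in> carrier G) \<Longrightarrow> word_eval G \<sigma> w \<in> carrier G"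
  by (induction w) auto

lemma word_eval_append:
  "(\<And>i. \<sigma> i \<in> carrier G) \<Longrightarrow> word_eval G \<sigma> (u @ v) = word_eval G \<sigma> u \<otimes> word_eval G \<sigma> v"
  by (induction u) (auto simp: m_assoc)

lemma word_eval_word_inv:
  assumes "\<And>i. \<sigma> i \<in> carrier G"
  shows "word_eval G \<sigma> (word_inv w) = inv (word_eval G \<sigma> w)"
proof (induction w)
  case Nil
  then show ?case by (simp add: word_inv_def)
next
  case (Cons p w)
  obtain i b where p: "p = (i, b)" by fastforce
  have "word_inv (p # w) = word_inv w @ [(i, \<not> b)]"
    by (simp add: word_inv_def p)
  then show ?case
    using Cons assms by (simp add: word_eval_append p inv_mult_group)
qed

definition commutator_of :: "'a \<Rightarrow> 'a \<Rightarrow> 'a" where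
  "commutator_of x y = inv x \<otimes> (inv y \<otimes> (x \<otimes> y))"

definition conj_by :: "'a \<Rightarrow> 'a \<Rightarrow> 'a" where
  "conj_by g x = inv g \<otimes> (x \<otimes> g)"

lemma conj_by_closed [simp]:
  "\<lbrakk>g \<in> carrier G; x \<in> carrier G\<rbrakk> \<Longrightarrow> conj_by g x \<in> carrier G"
  by (simp add: conj_by_def)

lemma commutator_of_closed [simp]:
  "\<lbrakk>x \<in> carrier G; y \<in> carrier G\<rbrakk> \<Longrightarrow> commutator_of x y \<in> carrier G"
  by (simp add: commutator_of_def)

lemma cancel_simps:
  assumes "x \<in> carrier G" "y \<in> carrier G"
  shows "x \<otimes> (inv x \<otimes> y) = y" "inv x \<otimes> (x \<otimes> y) = y"
  using assms by (simp_all flip: m_assoc)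

lemma conj_by_hom: "g \<in> carrier G \<Longrightarrow> conj_by g \<in> hom G G"
  by (rule homI) (auto simp: conj_by_def m_assoc cancel_simps)

lemma commutator_of_mult_left:
  assumes "x \<in> carrier G" "y \<in> carrier G" "z \<in> carrier G"
  shows "commutator_of (x \<otimes> y) z = conj_by y (commutator_of x z) \<otimes> commutator_of y z"
  using assms by (simp add: commutator_of_def conj_by_def inv_mult_group m_assoc cancel_simps)

lemma commutator_of_mult_right:
  assumes "x \<in> carrier G" "y \<in> carrier G" "z \<in> carrier G"
  shows "commutator_of x (y \<otimes> z) =
           conj_by (conj_by x z) (commutator_of x y) \<otimes> commutator_of x z"
  using assms by (simp add: commutator_of_def conj_by_def inv_mult_group m_assoc cancel_simps)

lemma word_eval_word_commutator:
  assumes "\<And>i. \<sigma> i \<in> carrier G"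
  shows "word_eval G \<sigma> (word_commutator u v) =
           commutator_of (word_eval G \<sigma> u) (word_eval G \<sigma> v)"
  using assms by (simp add: word_commutator_def word_eval_append word_eval_word_inv commutator_of_def)

lemma normal_conj_by:
  "\<lbrakk>M \<lhd> G; g \<in> carrier G; x \<in> M\<rbrakk> \<Longrightarrow> conj_by g x \<in> M"
  using normal.inv_op_closed1[of M G g x] subgroup.mem_carrier[OF normal_imp_subgroup, of M G x]
  by (simp add: conj_by_def m_assoc)

end

lemma word_eval_hom:
  assumes "group G" "group L" "h \<in> hom G L" "\<And>i. \<sigma> i \<in> carrier G"
  shows "word_eval L (\<lambda>i. h (\<sigma> i)) w = h (word_eval G \<sigma> w)"
proof -
  interpret group_hom G L h
    using assms by (simp add: group_hom_def group_hom_axioms_def)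
  show ?thesis
    using assms(4) by (induction w) auto
qed

lemma word_eval_subgroup:
  assumes "group G" "subgroup M G" "\<And>i. \<sigma> i \<in> M"
  shows "word_eval (G\<lparr>carrier := M\<rparr>) \<sigma> w = word_eval G \<sigma> w"
  using assms by (induction w) (auto simp: group.m_inv_consistent)

section \<open>Outer commutators are additive in each argument\<close>

text \<open>
  Induction on the commutator structure, by \<open>[xy, z] = [x, z]\<^sup>y [y, z]\<close> and
  \<open>[x, yz] = [x, y]\<^sup>g [x, z]\<close> with \<open>g = z\<^sup>x\<close>. The outer conjugation is absorbed into
  the arguments of the first factor, which stay in the normal subgroups where they were. The two
  assignments obtained for the half of the word that contains \<open>x\<^sub>k\<close> are extended by \<open>\<sigma>\<close>
  to the other half; this works because the halves have no letter in common.
\<close>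

lemma (in group) outer_commutator_mult_argument:
  assumes "outer_commutator t w" "k \<in> letters w"
    and "\<And>i. A i \<lhd> G" "M \<lhd> G" "L \<lhd> G" "\<And>i. \<sigma> i \<in> (A(k := M <#> L)) i"
  shows "\<exists>\<sigma>\<^sub>1 \<sigma>\<^sub>2. (\<forall>i. \<sigma>\<^sub>1 i \<in> (A(k := M)) i) \<and> (\<forall>i. \<sigma>\<^sub>2 i \<in> (A(k := L)) i) \<and>
           word_eval G \<sigma> w = word_eval G \<sigma>\<^sub>1 w \<otimes> word_eval G \<sigma>\<^sub>2 w"
  using assms(1,2)
proof (induction rule: outer_commutator.induct)
  case (letter i)
  then have [simp]: "i = k" by simp
  obtain a b where ab: "a \<in> M" "b \<in> L" "\<sigma> k = a \<otimes> b"
    using assms(6)[of k] by (auto simp: set_mult_def)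
  then have "a \<in> carrier G" "b \<in> carrier G"
    using assms(4,5) by (meson normal_imp_subgroup subgroup.mem_carrier)+
  then have "word_eval G \<sigma> [(i, True)] =
      word_eval G (\<sigma>(k := a)) [(i, True)] \<otimes> word_eval G (\<sigma>(k := b)) [(i, True)]"
    using ab by simp
  moreover have "(\<sigma>(k := a)) j \<in> (A(k := M)) j" "(\<sigma>(k := b)) j \<in> (A(k := L)) j" for j
    using ab(1,2) assms(6)[of j] by auto
  ultimately show ?case by blast
next
  case (commutator r u s v)
  have prod_normal: "M <#> L \<lhd> G"
    using assms(4,5) by (rule normal_subgroup_set_mult_closed)
  have \<sigma>: "\<sigma> i \<in> carrier G" for i
    using assms(3)[of i] assms(6)[of i] prod_normal
    by (metis fun_upd_apply normal_imp_subgroup subgroup.mem_carrier)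
  have \<sigma>A: "\<sigma> i \<in> A i" if "i \<noteq> k" for i
    using assms(6)[of i] that by simp
  have in_carrier: "\<tau> i \<in> carrier G"
    if "\<And>i. \<tau> i \<in> (A(k := B)) i" "B \<lhd> G" for \<tau> B i
    using that(1)[of i] that(2) assms(3)[of i]
    by (metis fun_upd_apply normal_imp_subgroup subgroup.mem_carrier)
  have patch: "(if i \<in> X then \<tau> i else \<sigma> i) \<in> (A(k := B)) i"
    if "\<And>i. \<tau> i \<in> (A(k := B)) i" "k \<in> X" for \<tau> B i X
    using that(1)[of i] that(2) \<sigma>A[of i] by auto
  have conj: "conj_by g (\<tau> i) \<in> (A(k := B)) i"
    if "\<And>i. \<tau> i \<in> (A(k := B)) i" "B \<lhd> G" "g \<in> carrier G" for \<tau> B i g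
    using that(1)[of i] that(2,3) assms(3)[of i] by (auto intro: normal_conj_by)
  have eval_conj: "word_eval G (\<lambda>i. conj_by g (\<tau> i)) z = conj_by g (word_eval G \<tau> z)"
    if "g \<in> carrier G" "\<And>i. \<tau> i \<in> carrier G" for g \<tau> z
    by (rule word_eval_hom[OF is_group is_group conj_by_hom[OF that(1)] that(2)])
  have eval_in: "word_eval G (\<lambda>i. if i \<in> letters z then \<tau> i else \<sigma> i) z = word_eval G \<tau> z"
    for \<tau> z by (rule word_eval_cong) simp
  have eval_out: "word_eval G (\<lambda>i. if i \<in> X then \<tau> i else \<sigma> i) z = word_eval G \<sigma> z"
    if "X \<inter> letters z = {}" for \<tau> z X
    by (rule word_eval_cong) (use that in auto)
  from commutator.prems consider "k \<in> letters u" | "k \<in> letters v" by auto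
  then show ?case
  proof cases
    case 1
    let ?p = "\<lambda>\<tau> i. if i \<in> letters u then \<tau> i else \<sigma> i"
    obtain \<sigma>\<^sub>1 \<sigma>\<^sub>2 where mem: "\<And>i. \<sigma>\<^sub>1 i \<in> (A(k := M)) i" "\<And>i. \<sigma>\<^sub>2 i \<in> (A(k := L)) i"
      and eq: "word_eval G \<sigma> u = word_eval G \<sigma>\<^sub>1 u \<otimes> word_eval G \<sigma>\<^sub>2 u"
      using commutator.IH(1) 1 by blast
    define y where "y = word_eval G \<sigma>\<^sub>2 u"
    have c: "\<And>i. \<sigma>\<^sub>1 i \<in> carrier G" "\<And>i. \<sigma>\<^sub>2 i \<in> carrier G"
      using in_carrier mem assms(4,5) by blast+
    have y: "y \<in> carrier G" by (simp add: y_def c)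
    have p: "\<And>i. ?p \<sigma>\<^sub>1 i \<in> (A(k := M)) i" "\<And>i. ?p \<sigma>\<^sub>2 i \<in> (A(k := L)) i"
      using patch[OF mem(1) 1] patch[OF mem(2) 1] by auto
    have pc: "\<And>i. ?p \<sigma>\<^sub>1 i \<in> carrier G" "\<And>i. ?p \<sigma>\<^sub>2 i \<in> carrier G"
      using c \<sigma> by auto
    have "word_eval G \<sigma> (word_commutator u v) =
        commutator_of (word_eval G \<sigma>\<^sub>1 u \<otimes> y) (word_eval G \<sigma> v)"
      by (simp only: word_eval_word_commutator[OF \<sigma>] eq y_def)
    also have "\<dots> = conj_by y (commutator_of (word_eval G \<sigma>\<^sub>1 u) (word_eval G \<sigma> v)) \<otimes>
        commutator_of y (word_eval G \<sigma> v)"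
      by (rule commutator_of_mult_left) (simp_all add: c \<sigma> y)
    also have "\<dots> = word_eval G (\<lambda>i. conj_by y (?p \<sigma>\<^sub>1 i)) (word_commutator u v) \<otimes>
        word_eval G (?p \<sigma>\<^sub>2) (word_commutator u v)"
      unfolding eval_conj[OF y pc(1)] word_eval_word_commutator[OF pc(1)]
        word_eval_word_commutator[OF pc(2)] eval_in eval_out[OF commutator.hyps(3)] y_def[symmetric] ..
    finally have split: "word_eval G \<sigma> (word_commutator u v) =
        word_eval G (\<lambda>i. conj_by y (?p \<sigma>\<^sub>1 i)) (word_commutator u v) \<otimes>
        word_eval G (?p \<sigma>\<^sub>2) (word_commutator u v)" .
    have "\<forall>i. conj_by y (?p \<sigma>\<^sub>1 i) \<in> (A(k := M)) i"
      by (rule allI, rule conj[OF p(1) assms(4) y])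
    moreover have "\<forall>i. ?p \<sigma>\<^sub>2 i \<in> (A(k := L)) i"
      by (rule allI, rule p(2))
    ultimately show ?thesis
      using split by - (rule exI, rule exI, rule conjI, assumption, rule conjI)
  next
    case 2
    let ?p = "\<lambda>\<tau> i. if i \<in> letters v then \<tau> i else \<sigma> i"
    obtain \<sigma>\<^sub>1 \<sigma>\<^sub>2 where mem: "\<And>i. \<sigma>\<^sub>1 i \<in> (A(k := M)) i" "\<And>i. \<sigma>\<^sub>2 i \<in> (A(k := L)) i"
      and eq: "word_eval G \<sigma> v = word_eval G \<sigma>\<^sub>1 v \<otimes> word_eval G \<sigma>\<^sub>2 v"
      using commutator.IH(2) 2 by blast
    have c: "\<And>i. \<sigma>\<^sub>1 i \<in> carrier G" "\<And>i. \<sigma>\<^sub>2 i \<in> carrier G"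
      using in_carrier mem assms(4,5) by blast+
    define g where "g = conj_by (word_eval G \<sigma> u) (word_eval G \<sigma>\<^sub>2 v)"
    have g: "g \<in> carrier G" by (simp add: g_def c \<sigma>)
    have p: "\<And>i. ?p \<sigma>\<^sub>1 i \<in> (A(k := M)) i" "\<And>i. ?p \<sigma>\<^sub>2 i \<in> (A(k := L)) i"
      using patch[OF mem(1) 2] patch[OF mem(2) 2] by auto
    have pc: "\<And>i. ?p \<sigma>\<^sub>1 i \<in> carrier G" "\<And>i. ?p \<sigma>\<^sub>2 i \<in> carrier G"
      using c \<sigma> by auto
    have disj: "letters v \<inter> letters u = {}"
      using commutator.hyps(3) by auto
    have "word_eval G \<sigma> (word_commutator u v) =
        commutator_of (word_eval G \<sigma> u) (word_eval G \<sigma>\<^sub>1 v \<otimes> word_eval G \<sigma>\<^sub>2 v)"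
      by (simp only: word_eval_word_commutator[OF \<sigma>] eq)
    also have "\<dots> = conj_by g (commutator_of (word_eval G \<sigma> u) (word_eval G \<sigma>\<^sub>1 v)) \<otimes>
        commutator_of (word_eval G \<sigma> u) (word_eval G \<sigma>\<^sub>2 v)"
      unfolding g_def by (rule commutator_of_mult_right) (simp_all add: c \<sigma>)
    also have "\<dots> = word_eval G (\<lambda>i. conj_by g (?p \<sigma>\<^sub>1 i)) (word_commutator u v) \<otimes>
        word_eval G (?p \<sigma>\<^sub>2) (word_commutator u v)"
      unfolding eval_conj[OF g pc(1)] word_eval_word_commutator[OF pc(1)]
        word_eval_word_commutator[OF pc(2)] eval_in eval_out[OF disj] ..
    finally have split: "word_eval G \<sigma> (word_commutator u v) =
        word_eval G (\<lambda>i. conj_by g (?p \<sigma>\<^sub>1 i)) (word_commutator u v) \<otimes>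
        word_eval G (?p \<sigma>\<^sub>2) (word_commutator u v)" .
    have "\<forall>i. conj_by g (?p \<sigma>\<^sub>1 i) \<in> (A(k := M)) i"
      by (rule allI, rule conj[OF p(1) assms(4) g])
    moreover have "\<forall>i. ?p \<sigma>\<^sub>2 i \<in> (A(k := L)) i"
      by (rule allI, rule p(2))
    ultimately show ?thesis
      using split by - (rule exI, rule exI, rule conjI, assumption, rule conjI)
  qed
qed

definition vanishes_on :: "('a, 'b) monoid_scheme \<Rightarrow> group_word \<Rightarrow> (nat \<Rightarrow> 'a set) \<Rightarrow> bool" where
  "vanishes_on G w A \<longleftrightarrow> (\<forall>\<sigma>. (\<forall>i. \<sigma> i \<in> A i) \<longrightarrow> word_eval G \<sigma> w = \<one>\<^bsub>G\<^esub>)"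

lemma vanishes_on_mono:
  "\<lbrakk>vanishes_on G w A; \<And>i. B i \<subseteq> A i\<rbrakk> \<Longrightarrow> vanishes_on G w B"
  unfolding vanishes_on_def by blast

text \<open>
  For \<open>w = [x, y]\<close> this says that \<open>[M, B] = [L, B] = 1\<close> implies \<open>[ML, B] = 1\<close>, a case of the
  distributivity of mutual commutators of normal subgroups over products.
\<close>

lemma (in group) vanishes_on_set_mult:
  assumes "outer_commutator t w" "k \<in> letters w" "\<And>i. A i \<lhd> G" "M \<lhd> G" "L \<lhd> G"
    and "vanishes_on G w (A(k := M))" "vanishes_on G w (A(k := L))"
  shows "vanishes_on G w (A(k := M <#> L))"
  unfolding vanishes_on_def
proof (intro allI impI)
  fix \<sigma> assume "\<forall>i. \<sigma> i \<in> (A(k := M <#> L)) i"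
  then obtain \<sigma>\<^sub>1 \<sigma>\<^sub>2 where "\<forall>i. \<sigma>\<^sub>1 i \<in> (A(k := M)) i" "\<forall>i. \<sigma>\<^sub>2 i \<in> (A(k := L)) i"
    "word_eval G \<sigma> w = word_eval G \<sigma>\<^sub>1 w \<otimes> word_eval G \<sigma>\<^sub>2 w"
    using outer_commutator_mult_argument[where A = A, OF assms(1-5)] by blast
  then show "word_eval G \<sigma> w = \<one>"
    using assms(6,7) by (simp add: vanishes_on_def)
qed

lemma vanishes_on_image:
  assumes "group G" "\<phi> \<in> hom G G" "\<And>i. A i \<subseteq> carrier G" "vanishes_on G w A"
  shows "vanishes_on G w (\<lambda>i. \<phi> ` A i)"
  unfolding vanishes_on_def
proof (intro allI impI)
  fix \<sigma> assume "\<forall>i. \<sigma> i \<in> \<phi> ` A i"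
  then have "\<forall>i. \<exists>a. a \<in> A i \<and> \<sigma> i = \<phi> a" by blast
  then obtain \<tau> where \<tau>: "\<And>i. \<tau> i \<in> A i" "\<And>i. \<sigma> i = \<phi> (\<tau> i)" by metis
  interpret group_hom G G \<phi>
    using assms by (simp add: group_hom_def group_hom_axioms_def)
  have "\<sigma> = (\<lambda>i. \<phi> (\<tau> i))" using \<tau>(2) by blast
  then have "word_eval G \<sigma> w = \<phi> (word_eval G \<tau> w)"
    using word_eval_hom[OF assms(1,1,2), of \<tau> w] \<tau>(1) assms(3) by blast
  then show "word_eval G \<sigma> w = \<one>\<^bsub>G\<^esub>"
    using assms(4) \<tau>(1) by (simp add: vanishes_on_def)
qed

lemma satisfies_identity_iff_vanishes_on:
  assumes "group G" "subgroup M G"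
  shows "satisfies_identity (G\<lparr>carrier := M\<rparr>) w \<longleftrightarrow> vanishes_on G w (\<lambda>_. M)"
  using word_eval_subgroup[OF assms] by (simp add: satisfies_identity_def vanishes_on_def)

section \<open>Large normal subgroups\<close>

lemma group_hom_epi:
  assumes "group G" "group L" "h \<in> epi G L"
  shows "group_hom G L h"
  using assms by (simp add: group_hom_def group_hom_axioms_def epi_def)

lemma iso_if_epi_same_kernel:
  assumes "group G" "group L" "group Q" "h \<in> epi G L" "q \<in> epi G Q"
    and "kernel G L h = kernel G Q q"
  shows "L \<cong> Q"
proof -
  interpret h: group_hom G L h by (rule group_hom_epi[OF assms(1,2,4)])
  interpret q: group_hom G Q q by (rule group_hom_epi[OF assms(1,3,5)])
  have "G Mod kernel G L h \<cong> L" "G Mod kernel G L h \<cong> Q"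
    using h.FactGroup_iso q.FactGroup_iso assms(4-6) by (auto simp: epi_def)
  then show ?thesis
    using group.iso_sym normal.factorgroup_is_group[OF h.normal_kernel] iso_trans by blast
qed

lemma has_property_iso:
  "\<lbrakk>K \<cong> L; has_property P L\<rbrakk> \<Longrightarrow> has_property P K"
  unfolding has_property_def using iso_trans by blast

lemma epi_Mod:
  assumes "group G" "N \<lhd> G"
  shows "(\<lambda>a. N #>\<^bsub>G\<^esub> a) \<in> epi G (G Mod N)"
  using normal.r_coset_hom_Mod[OF assms(2)] by (auto simp: epi_def FactGroup_def RCOSETS_def)

lemma kernel_Mod:
  assumes "group G" "N \<lhd> G"
  shows "kernel G (G Mod N) (\<lambda>a. N #>\<^bsub>G\<^esub> a) = N"
proof -
  interpret group G by fact
  have N: "subgroup N G" by (rule normal_imp_subgroup[OF assms(2)])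
  have "N #>\<^bsub>G\<^esub> a = N \<longleftrightarrow> a \<in> N" if "a \<in> carrier G" for a
    using coset_join1[OF _ that N] coset_join2[OF that N] by blast
  then show ?thesis
    using subgroup.mem_carrier[OF N] by (auto simp: kernel_def FactGroup_def)
qed

text \<open>
  Equivalently, \<open>N\<close> is the kernel of an epimorphism of \<open>G\<close> onto a group over the universe \<open>'u\<close>
  that satisfies \<open>P\<close> (\<open>large_kernel\<close>, \<open>large_obtain_epi\<close>). Through such epimorphisms the axioms
  of smallness, which speak of groups over \<open>'u\<close>, are transported to normal subgroups of \<open>G\<close>.
\<close>

definition large :: "('u monoid \<Rightarrow> bool) \<Rightarrow> ('a, 'b) monoid_scheme \<Rightarrow> 'a set \<Rightarrow> bool" where
  "large P G N \<longleftrightarrow> N \<lhd> G \<and> has_property P (G Mod N)"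

lemma large_kernel:
  assumes "group G" "group L" "h \<in> epi G L" "has_property P L"
  shows "large P G (kernel G L h)"
proof -
  interpret group_hom G L h by (rule group_hom_epi[OF assms(1-3)])
  have "G Mod kernel G L h \<cong> L"
    using FactGroup_iso assms(3) by (simp add: epi_def)
  then show ?thesis
    using normal_kernel has_property_iso assms(4) by (auto simp: large_def)
qed

lemma large_obtain_epi:
  fixes P :: "'u monoid \<Rightarrow> bool"
  assumes "group G" "large P G N"
  obtains L :: "'u monoid" and h
  where "group L" "P L" "h \<in> epi G L" "kernel G L h = N"
proof -
  have N: "N \<lhd> G" using assms(2) by (simp add: large_def)
  obtain L :: "'u monoid" and f where L: "group L" "P L" and f: "f \<in> iso (G Mod N) L"
    using assms(2) by (auto simp: large_def has_property_def is_iso_def)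
  let ?c = "\<lambda>a. N #>\<^bsub>G\<^esub> a"
  have fe: "f \<in> epi (G Mod N) L" using f by (simp add: iso_iff_mon_epi)
  have M: "group (G Mod N)" by (rule normal.factorgroup_is_group[OF N])
  interpret f: group_hom "G Mod N" L f by (rule group_hom_epi[OF M L(1) fe])
  have c: "?c \<in> epi G (G Mod N)" by (rule epi_Mod[OF assms(1) N])
  have "f x = \<one>\<^bsub>L\<^esub> \<longleftrightarrow> x = \<one>\<^bsub>G Mod N\<^esub>" if "x \<in> carrier (G Mod N)" for x
    using f that f.iso_iff f.hom_one by auto
  moreover have "?c a \<in> carrier (G Mod N)" if "a \<in> carrier G" for a
    using c that by (auto simp: epi_def)
  ultimately have "kernel G L (f \<circ> ?c) = kernel G (G Mod N) ?c"
    by (auto simp: kernel_def)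
  then show ?thesis
    using that[OF L epi_compose[OF c fe]] kernel_Mod[OF assms(1) N] by simp
qed

lemma (in group_hom) vimage_image_normal:
  assumes "M \<lhd> G" "kernel G H h \<subseteq> M" "x \<in> carrier G" "h x \<in> h ` M"
  shows "x \<in> M"
proof -
  have M: "subgroup M G" by (rule normal_imp_subgroup[OF assms(1)])
  obtain m where m: "m \<in> M" "h x = h m" using assms(4) by blast
  have mc: "m \<in> carrier G" by (rule subgroup.mem_carrier[OF M m(1)])
  have "x \<otimes> inv m \<in> kernel G H h"
    using m mc assms(3) by (simp add: kernel_def)
  then have "x \<otimes> inv m \<otimes> m \<in> M"
    using assms(2) subgroup.m_closed[OF M _ m(1)] by blast
  then show ?thesis
    using mc assms(3) by (simp add: G.m_assoc)
qed

lemma epi_image_normal: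
  assumes "group G" "group L" "h \<in> epi G L" "M \<lhd> G"
  shows "h ` M \<lhd> L"
  using normal.surj_hom_normal_subgroup[OF assms(4) group_hom_epi[OF assms(1-3)]] assms(3)
  by (simp add: epi_def)

lemma large_supergroup:
  assumes "smallness_property P" "group G" "large P G N" "M \<lhd> G" "N \<subseteq> M"
  shows "large P G M"
proof -
  obtain L h where L: "group L" "P L" "h \<in> epi G L" "kernel G L h = N"
    by (rule large_obtain_epi[OF assms(2,3)])
  interpret group_hom G L h by (rule group_hom_epi[OF assms(2) L(1,3)])
  have hM: "h ` M \<lhd> L" by (rule epi_image_normal[OF assms(2) L(1,3) assms(4)])
  let ?q = "(\<lambda>a. h ` M #>\<^bsub>L\<^esub> a) \<circ> h"
  have q: "?q \<in> epi G (L Mod h ` M)"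
    by (rule epi_compose[OF L(3) epi_Mod[OF L(1) hM]])
  have "kernel G (L Mod h ` M) ?q = {a \<in> carrier G. h a \<in> h ` M}"
    using kernel_Mod[OF L(1) hM] by (auto simp: kernel_def)
  also have "\<dots> = M"
    using vimage_image_normal[OF assms(4)] L(4) assms(5)
      subgroup.mem_carrier[OF normal_imp_subgroup[OF assms(4)]] by auto
  finally show ?thesis
    using large_kernel[OF assms(2) normal.factorgroup_is_group[OF hM] q] assms(1) L(1,2) hM
    unfolding smallness_property_def by (metis (no_types, lifting))
qed

lemma epi_vimage_normal:
  assumes "group G" "group L" "h \<in> epi G L" "M \<lhd> L"
  shows "{a \<in> carrier G. h a \<in> M} \<lhd> G"
proof -
  let ?q = "(\<lambda>a. M #>\<^bsub>L\<^esub> a) \<circ> h"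
  have q: "?q \<in> epi G (L Mod M)"
    by (rule epi_compose[OF assms(3) epi_Mod[OF assms(2,4)]])
  interpret group_hom G L h by (rule group_hom_epi[OF assms(1-3)])
  interpret q: group_hom G "L Mod M" ?q
    by (rule group_hom_epi[OF assms(1) normal.factorgroup_is_group[OF assms(4)] q])
  have "kernel G (L Mod M) ?q = {a \<in> carrier G. h a \<in> M}"
    using kernel_Mod[OF assms(2,4)] by (auto simp: kernel_def)
  then show ?thesis using q.normal_kernel by simp
qed

text \<open>
  The quotient \<open>G/\<phi>(N)\<close> is isomorphic to \<open>G/\<phi>\<^sup>-\<^sup>1(\<phi>(N))\<close>, and
  \<open>\<phi>\<^sup>-\<^sup>1(\<phi>(N))\<close> contains \<open>N\<close>.
\<close>

lemma large_image:
  assumes "smallness_property P" "group G" "large P G N" "\<phi> \<in> epi G G"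
  shows "large P G (\<phi> ` N)"
proof -
  have N: "N \<lhd> G" using assms(3) by (simp add: large_def)
  have \<phi>N: "\<phi> ` N \<lhd> G" by (rule epi_image_normal[OF assms(2,2,4) N])
  let ?M = "{a \<in> carrier G. \<phi> a \<in> \<phi> ` N}"
  let ?q = "(\<lambda>a. \<phi> ` N #>\<^bsub>G\<^esub> a) \<circ> \<phi>"
  interpret group_hom G G \<phi> by (rule group_hom_epi[OF assms(2,2,4)])
  have M: "?M \<lhd> G" by (rule epi_vimage_normal[OF assms(2,2,4) \<phi>N])
  have "N \<subseteq> ?M"
    using subgroup.mem_carrier[OF normal_imp_subgroup[OF N]] by blast
  then have "large P G ?M"
    by (rule large_supergroup[OF assms(1-3) M])
  moreover have "G Mod ?M \<cong> G Mod \<phi> ` N"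
  proof (rule iso_if_epi_same_kernel)
    show "kernel G (G Mod ?M) (\<lambda>a. ?M #>\<^bsub>G\<^esub> a) = kernel G (G Mod \<phi> ` N) ?q"
      unfolding kernel_Mod[OF assms(2) M]
      using kernel_Mod[OF assms(2) \<phi>N] by (auto simp: kernel_def)
  qed (rule assms(2) normal.factorgroup_is_group[OF M] normal.factorgroup_is_group[OF \<phi>N]
      epi_Mod[OF assms(2) M] epi_compose[OF assms(4) epi_Mod[OF assms(2) \<phi>N]])+
  then have "G Mod \<phi> ` N \<cong> G Mod ?M"
    using group.iso_sym[OF normal.factorgroup_is_group[OF M]] by blast
  ultimately show ?thesis
    using \<phi>N has_property_iso by (auto simp: large_def)
qed

text \<open>
  The diagonal map embeds \<open>G/(M \<inter> N)\<close> as a subdirect product of \<open>G/M\<close> and \<open>G/N\<close>.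
\<close>

lemma large_Int:
  fixes P :: "'u monoid \<Rightarrow> bool"
  assumes "smallness_property P" "group G" "large P G M" "large P G N"
  shows "large P G (M \<inter> N)"
proof -
  obtain K :: "'u monoid" and f where K: "group K" "P K" "f \<in> epi G K" "kernel G K f = M"
    by (rule large_obtain_epi[OF assms(2,3)])
  obtain L :: "'u monoid" and h where L: "group L" "P L" "h \<in> epi G L" "kernel G L h = N"
    by (rule large_obtain_epi[OF assms(2,4)])
  interpret f: group_hom G K f by (rule group_hom_epi[OF assms(2) K(1,3)])
  interpret h: group_hom G L h by (rule group_hom_epi[OF assms(2) L(1,3)])
  let ?d = "\<lambda>a. (f a, h a)"
  let ?S = "?d ` carrier G"
  have D: "group (K \<times>\<times> L)" by (rule DirProd_group[OF K(1) L(1)])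
  have d: "?d \<in> hom G (K \<times>\<times> L)" by (rule homI) auto
  interpret d: group_hom G "K \<times>\<times> L" ?d
    using D d assms(2) by (simp add: group_hom_def group_hom_axioms_def)
  have S: "subgroup ?S (K \<times>\<times> L)" by (rule d.img_is_subgroup)
  have "subdirect_product ?S K L"
    using S K(3) L(3) by (simp add: subdirect_product_def epi_def image_image)
  then have "has_property P ((K \<times>\<times> L)\<lparr>carrier := ?S\<rparr>)"
    using assms(1) K(1,2) L(1,2) by (simp add: smallness_property_def)
  moreover have "?d \<in> epi G ((K \<times>\<times> L)\<lparr>carrier := ?S\<rparr>)"
    using d by (auto simp: epi_def hom_def)
  moreover have "group ((K \<times>\<times> L)\<lparr>carrier := ?S\<rparr>)"
    by (rule subgroup.subgroup_is_group[OF S D])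
  ultimately have "large P G (kernel G ((K \<times>\<times> L)\<lparr>carrier := ?S\<rparr>) ?d)"
    using large_kernel[OF assms(2)] by blast
  moreover have "kernel G ((K \<times>\<times> L)\<lparr>carrier := ?S\<rparr>) ?d = M \<inter> N"
    using K(4) L(4) by (auto simp: kernel_def)
  ultimately show ?thesis by simp
qed

lemma large_chain_stabilises:
  fixes M :: "nat \<Rightarrow> 'a set"
  assumes "smallness_property P" "group G" "large P G (M 0)"
    and "\<And>i. M i \<lhd> G" "\<And>i. M i \<subseteq> M (Suc i)"
  shows "\<exists>n. \<forall>m\<ge>n. M m = M n"
proof -
  obtain L h where L: "group L" "P L" "h \<in> epi G L" "kernel G L h = M 0"
    by (rule large_obtain_epi[OF assms(2,3)])
  interpret group_hom G L h by (rule group_hom_epi[OF assms(2) L(1,3)])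
  have "max_normal L"
    using assms(1) L(1,2) by (simp add: smallness_property_def)
  moreover have "h ` M i \<lhd> L" for i
    by (rule epi_image_normal[OF assms(2) L(1,3) assms(4)])
  moreover have "h ` M i \<subseteq> h ` M (Suc i)" for i
    by (rule image_mono[OF assms(5)])
  ultimately have "\<exists>n. \<forall>m\<ge>n. h ` M m = h ` M n"
    unfolding max_normal_def by (elim allE[of _ "\<lambda>i. h ` M i"] impE) (intro conjI allI)
  then obtain n where n: "\<forall>m\<ge>n. h ` M m = h ` M n" by blast
  have M0: "kernel G L h \<subseteq> M i" for i
    unfolding L(4) by (rule lift_Suc_mono_le[where f = M, OF assms(5)]) simp
  have sub: "M i \<subseteq> M j" if "h ` M i = h ` M j" for i j
  proof
    fix x assume x: "x \<in> M i"
    have "x \<in> carrier G"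
      by (rule subgroup.mem_carrier[OF normal_imp_subgroup[OF assms(4)] x])
    moreover have "h x \<in> h ` M j"
      unfolding that[symmetric] using x by (rule imageI)
    ultimately show "x \<in> M j"
      by (rule vimage_image_normal[OF assms(4) M0])
  qed
  show ?thesis
  proof (intro exI allI impI)
    fix m assume "m \<ge> n"
    then have "h ` M m = h ` M n" by (rule n[rule_format])
    then show "M m = M n" using sub[of m n] sub[OF sym, of m n] by (intro equalityI)
  qed
qed

lemma large_family_has_maximal:
  fixes G :: "('a, 'b) monoid_scheme"
  assumes "smallness_property P" "group G"
    and "\<Q> \<noteq> {}" "\<And>M. M \<in> \<Q> \<Longrightarrow> large P G M"
  shows "\<exists>M\<in>\<Q>. \<forall>M'\<in>\<Q>. M \<subseteq> M' \<longrightarrow> M' = M"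
proof (rule ccontr)
  assume "\<not> ?thesis"
  then have step: "\<exists>M'. M' \<in> \<Q> \<and> M \<subset> M'" if "M \<in> \<Q>" for M using that by blast
  have "\<exists>C. \<forall>i. C i \<in> \<Q> \<and> C i \<subset> C (Suc i)"
  proof (rule dependent_nat_choice)
    show "\<exists>M. M \<in> \<Q>" using assms(3) by blast
    show "\<exists>M'. M' \<in> \<Q> \<and> M \<subset> M'" if "M \<in> \<Q>" for M n
      by (rule step[OF that])
  qed
  then obtain C where C: "\<And>i. C i \<in> \<Q>" "\<And>i. C i \<subset> C (Suc i)" by blast
  have large: "large P G (C i)" for i by (rule assms(4)[OF C(1)])
  have normal: "C i \<lhd> G" for i using large[of i] by (simp add: large_def)
  have "\<exists>n. \<forall>m\<ge>n. C m = C n"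
    by (rule large_chain_stabilises[where M = C, OF assms(1,2) large normal psubset_imp_subset[OF C(2)]])
  then obtain n where "\<forall>m\<ge>n. C m = C n" by blast
  then have "C (Suc n) = C n" by (elim allE[of _ "Suc n"]) simp
  then show False using C(2)[of n] by simp
qed

text \<open>
  The Hopfian argument: the iterated preimages \<open>\<phi>\<^sup>-\<^sup>n(H)\<close> form an increasing chain of
  normal subgroups above \<open>H\<close>, so two consecutive ones coincide; applying the surjection \<open>\<phi>\<close>
  repeatedly to this equality gives \<open>\<phi>\<^sup>-\<^sup>1(H) = H\<close>.
\<close>

lemma large_epi_invariant_eq:
  assumes "smallness_property P" "group G" "large P G H" "\<phi> \<in> epi G G" "\<phi> ` H \<subseteq> H"
  shows "\<phi> ` H = H"
proof -
  interpret group_hom G G \<phi> by (rule group_hom_epi[OF assms(2,2,4)])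
  have H: "H \<lhd> G" using assms(3) by (simp add: large_def)
  have Hc: "H \<subseteq> carrier G" by (rule subgroup.subset[OF normal_imp_subgroup[OF H]])
  have surj: "\<phi> ` carrier G = carrier G" using assms(4) by (simp add: epi_def)
  define C where "C n = ((\<lambda>A. {a \<in> carrier G. \<phi> a \<in> A}) ^^ n) H" for n
  have C_Suc: "C (Suc n) = {a \<in> carrier G. \<phi> a \<in> C n}" for n
    by (simp add: C_def)
  have normal: "C n \<lhd> G" for n
  proof (induction n)
    case 0
    show ?case using H by (simp add: C_def)
  next
    case (Suc n)
    show ?case unfolding C_Suc by (rule epi_vimage_normal[OF assms(2,2,4) Suc.IH])
  qed
  have mono: "C n \<subseteq> C (Suc n)" for n
  proof (induction n)
    case 0
    then show ?case using assms(5) Hc by (auto simp: C_def)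
  next
    case (Suc n)
    then show ?case by (auto simp: C_Suc)
  qed
  have "\<exists>n. \<forall>m\<ge>n. C m = C n"
    by (rule large_chain_stabilises[where M = C, OF assms(1,2) _ normal mono])
      (simp add: C_def assms(3))
  then obtain n where "\<forall>m\<ge>n. C m = C n" by blast
  then have "C (Suc n) = C n" by (elim allE[of _ "Suc n"]) simp
  then have "C (Suc 0) = C 0"
  proof (induction n)
    case (Suc n)
    have img: "\<phi> ` C (Suc m) = C m" for m
    proof
      show "\<phi> ` C (Suc m) \<subseteq> C m" by (auto simp: C_Suc)
      have "C m \<subseteq> \<phi> ` carrier G"
        unfolding surj by (rule subgroup.subset[OF normal_imp_subgroup[OF normal]])
      then show "C m \<subseteq> \<phi> ` C (Suc m)" by (auto simp: C_Suc)
    qed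
    show ?case
      using Suc.IH arg_cong[OF Suc.prems, of "(`) \<phi>"] by (simp add: img)
  qed
  then have pre: "{a \<in> carrier G. \<phi> a \<in> H} \<subseteq> H" by (simp add: C_def)
  have "H \<subseteq> \<phi> ` H"
  proof
    fix x assume x: "x \<in> H"
    then obtain a where a: "a \<in> carrier G" "x = \<phi> a"
      using surj Hc by (metis imageE subsetD)
    then have "a \<in> H" using pre x by blast
    then show "x \<in> \<phi> ` H" unfolding a(2) by (rule imageI)
  qed
  with assms(5) show ?thesis by (rule equalityI)
qed

section \<open>Making the arguments invariant one by one\<close>

text \<open>
  The induction step over the letters of \<open>w\<close>. The price for making one more argument invariant is
  that both subgroups may shrink: \<open>H'\<close> is the intersection of \<open>H\<close> with the invariant range found
  for the letter \<open>k\<close>, and \<open>K'\<close> is a range for the remaining letters that goes with it.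
\<close>

lemma invariant_argument_step:
  fixes P :: "'u monoid \<Rightarrow> bool"
  assumes P: "smallness_property P" and G: "group G" and w: "outer_commutator t w"
    and k: "k \<in> letters w" "k \<notin> S"
    and H: "large P G H" "\<And>\<phi>. \<phi> \<in> epi G G \<Longrightarrow> \<phi> ` H \<subseteq> H"
    and K: "large P G K" "vanishes_on G w (\<lambda>i. if i \<in> S then H else K)"
  obtains H' K' where "large P G H'" "\<And>\<phi>. \<phi> \<in> epi G G \<Longrightarrow> \<phi> ` H' \<subseteq> H'"
    "large P G K'" "vanishes_on G w (\<lambda>i. if i \<in> insert k S then H' else K')"
proof -
  interpret group G by fact
  define A where "A K = (\<lambda>i. if i \<in> S then H else K)" for K :: "'a set"
  \<comment> \<open>The range \<open>K\<close> of the remaining letters is not fixed: products and images of members of \<open>\<Q>\<close>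
    need other choices of it, and this freedom makes \<open>\<Q>\<close> closed under both operations.\<close>
  define \<Q> where "\<Q> = {M. large P G M \<and> (\<exists>K. large P G K \<and> vanishes_on G w ((A K)(k := M)))}"
  have A: "A K i \<lhd> G" if "large P G K" for K i
    using that H(1) by (simp add: A_def large_def)
  have "(A K)(k := K) = A K" by (rule ext) (simp add: A_def k(2))
  moreover have "vanishes_on G w (A K)" unfolding A_def by (rule K(2))
  ultimately have "vanishes_on G w ((A K)(k := K))" by (simp only:)
  then have "K \<in> \<Q>"
    unfolding \<Q>_def using K(1) by blast
  then have "\<Q> \<noteq> {}" by blast
  moreover have "large P G M" if "M \<in> \<Q>" for M using that by (simp add: \<Q>_def)
  ultimately have "\<exists>M\<in>\<Q>. \<forall>M'\<in>\<Q>. M \<subseteq> M' \<longrightarrow> M' = M"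
    by (rule large_family_has_maximal[OF P G])
  then obtain M where M: "M \<in> \<Q>" "\<And>M'. \<lbrakk>M' \<in> \<Q>; M \<subseteq> M'\<rbrakk> \<Longrightarrow> M' = M"
    by blast
  have join: "M1 <#>\<^bsub>G\<^esub> M2 \<in> \<Q>" "M1 \<subseteq> M1 <#>\<^bsub>G\<^esub> M2" "M2 \<subseteq> M1 <#>\<^bsub>G\<^esub> M2"
    if M12: "M1 \<in> \<Q>" "M2 \<in> \<Q>" for M1 M2
  proof -
    obtain K1 K2 where K12: "large P G K1" "vanishes_on G w ((A K1)(k := M1))"
      "large P G K2" "vanishes_on G w ((A K2)(k := M2))"
      using M12 by (auto simp: \<Q>_def)
    have l: "large P G M1" "large P G M2" using M12 by (auto simp: \<Q>_def)
    then have n: "M1 \<lhd> G" "M2 \<lhd> G" by (auto simp: large_def)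
    then have s: "subgroup M1 G" "subgroup M2 G" by (auto intro: normal_imp_subgroup)
    show sub: "M1 \<subseteq> M1 <#>\<^bsub>G\<^esub> M2" "M2 \<subseteq> M1 <#>\<^bsub>G\<^esub> M2"
      using subgroup.one_closed[OF s(1)] subgroup.one_closed[OF s(2)]
        subgroup.mem_carrier[OF s(1)] subgroup.mem_carrier[OF s(2)]
      unfolding set_mult_def by force+
    have "large P G (M1 <#>\<^bsub>G\<^esub> M2)"
      by (rule large_supergroup[OF P G l(1) normal_subgroup_set_mult_closed[OF n] sub(1)])
    moreover have KK: "large P G (K1 \<inter> K2)" by (rule large_Int[OF P G K12(1,3)])
    moreover have "vanishes_on G w ((A (K1 \<inter> K2))(k := M1 <#>\<^bsub>G\<^esub> M2))"
    proof (rule vanishes_on_set_mult[OF w k(1) A[OF KK] n])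
      show "vanishes_on G w ((A (K1 \<inter> K2))(k := M1))"
        by (rule vanishes_on_mono[OF K12(2)]) (auto simp: A_def)
      show "vanishes_on G w ((A (K1 \<inter> K2))(k := M2))"
        by (rule vanishes_on_mono[OF K12(4)]) (auto simp: A_def)
    qed
    ultimately show "M1 <#>\<^bsub>G\<^esub> M2 \<in> \<Q>" by (auto simp: \<Q>_def)
  qed
  \<comment> \<open>A maximal element of a family closed under products is its greatest element.\<close>
  have greatest: "M' \<subseteq> M" if "M' \<in> \<Q>" for M'
    using join(3)[OF M(1) that] unfolding M(2)[OF join(1)[OF M(1) that] join(2)[OF M(1) that]] .
  have M_inv: "\<phi> ` M \<subseteq> M" if \<phi>: "\<phi> \<in> epi G G" for \<phi>
  proof (rule greatest)
    obtain K1 where K1: "large P G K1" "vanishes_on G w ((A K1)(k := M))" "large P G M"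
      using M(1) by (auto simp: \<Q>_def)
    have "\<phi> ` H = H" by (rule large_epi_invariant_eq[OF P G H(1) \<phi> H(2)[OF \<phi>]])
    then have eq: "(A (\<phi> ` K1))(k := \<phi> ` M) = (\<lambda>i. \<phi> ` ((A K1)(k := M)) i)"
      by (intro ext) (simp add: A_def)
    have "((A K1)(k := M)) i \<lhd> G" for i
      using A[OF K1(1)] K1(3) by (simp add: large_def)
    then have in_carrier: "((A K1)(k := M)) i \<subseteq> carrier G" for i
      using normal_imp_subgroup subgroup.subset by blast
    have "\<phi> \<in> hom G G" using \<phi> by (simp add: epi_def)
    then have "vanishes_on G w ((A (\<phi> ` K1))(k := \<phi> ` M))"
      unfolding eq by (rule vanishes_on_image[OF G _ in_carrier K1(2)])
    then show "\<phi> ` M \<in> \<Q>"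
      using large_image[OF P G _ \<phi>] K1 by (auto simp: \<Q>_def)
  qed
  obtain K' where K': "large P G K'" "vanishes_on G w ((A K')(k := M))" "large P G M"
    using M(1) by (auto simp: \<Q>_def)
  show ?thesis
  proof (rule that)
    show "large P G (H \<inter> M)" by (rule large_Int[OF P G H(1) K'(3)])
    show "\<phi> ` (H \<inter> M) \<subseteq> H \<inter> M" if "\<phi> \<in> epi G G" for \<phi>
      using H(2)[OF that] M_inv[OF that] by blast
    show "large P G K'" by fact
    show "vanishes_on G w (\<lambda>i. if i \<in> insert k S then H \<inter> M else K')"
      by (rule vanishes_on_mono[OF K'(2)]) (auto simp: A_def)
  qed
qed

theorem theorem4:
  fixes P :: "'u monoid \<Rightarrow> bool"
    and G :: "('a, 'b) monoid_scheme"
    and N :: "'a set"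
    and t :: nat
    and w :: group_word
  assumes "smallness_property P"
    and "group G"
    and "outer_commutator t w"
    and "N \<lhd> G"
    and "satisfies_identity (G\<lparr>carrier := N\<rparr>) w"
    and "has_property P (G Mod N)"
  shows "\<exists>H. characteristic H G \<and> surj_endo_invariant H G \<and>
             satisfies_identity (G\<lparr>carrier := H\<rparr>) w \<and> has_property P (G Mod H)"
proof -
  interpret group G by fact
  have N: "large P G N" using assms(4,6) by (simp add: large_def)
  have "\<exists>H K. large P G H \<and> (\<forall>\<phi>\<in>epi G G. \<phi> ` H \<subseteq> H) \<and> large P G K \<and>
      vanishes_on G w (\<lambda>i. if i \<in> S then H else K)"
    if "finite S" "S \<subseteq> letters w" for S
    using that
  proof (induction S rule: finite_induct)
    case empty
    have "carrier G \<lhd> G" by (rule normal_invI[OF subgroup_self]) simp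
    moreover have "N \<subseteq> carrier G"
      by (rule subgroup.subset[OF normal_imp_subgroup[OF assms(4)]])
    ultimately have "large P G (carrier G)"
      using large_supergroup[OF assms(1,2) N] by blast
    moreover have "vanishes_on G w (\<lambda>_. N)"
      using satisfies_identity_iff_vanishes_on[OF assms(2) normal_imp_subgroup[OF assms(4)]]
        assms(5) by blast
    ultimately show ?case
      using N by (intro exI[of _ "carrier G"] exI[of _ N]) (auto simp: epi_def)
  next
    case (insert k S)
    then obtain H K where HK: "large P G H" "\<forall>\<phi>\<in>epi G G. \<phi> ` H \<subseteq> H" "large P G K"
      "vanishes_on G w (\<lambda>i. if i \<in> S then H else K)"
      by auto
    obtain H' K' where "large P G H'" "\<And>\<phi>. \<phi> \<in> epi G G \<Longrightarrow> \<phi> ` H' \<subseteq> H'"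
      "large P G K'" "vanishes_on G w (\<lambda>i. if i \<in> insert k S then H' else K')"
      using invariant_argument_step[OF assms(1-3) _ insert.hyps(2) HK(1) _ HK(3,4)]
        HK(2) insert.prems by (metis insert_subset)
    then show ?case by (intro exI[of _ H'] exI[of _ K']) simp
  qed
  from this[OF finite_letters order_refl] obtain H K where
    H: "large P G H" "\<And>\<phi>. \<phi> \<in> epi G G \<Longrightarrow> \<phi> ` H \<subseteq> H" and K: "large P G K"
    and van: "vanishes_on G w (\<lambda>i. if i \<in> letters w then H else K)"
    by blast
  have Hs: "subgroup H G" and Ks: "subgroup K G"
    using H(1) K normal_imp_subgroup by (auto simp: large_def)
  have "vanishes_on G w (\<lambda>_. H)"
    unfolding vanishes_on_def
  proof (intro allI impI)
    fix \<sigma> :: "nat \<Rightarrow> 'a" assume \<sigma>: "\<forall>i. \<sigma> i \<in> H"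
    \<comment> \<open>Only the letters of \<open>w\<close> are known to range over \<open>H\<close>; the others, which do not affect the
      value, are sent to the identity, an element of \<open>K\<close>.\<close>
    let ?\<tau> = "\<lambda>i. if i \<in> letters w then \<sigma> i else \<one>\<^bsub>G\<^esub>"
    have "word_eval G \<sigma> w = word_eval G ?\<tau> w" by (rule word_eval_cong) simp
    also have "\<dots> = \<one>\<^bsub>G\<^esub>"
      using van \<sigma> subgroup.one_closed[OF Ks] unfolding vanishes_on_def by simp
    finally show "word_eval G \<sigma> w = \<one>\<^bsub>G\<^esub>" .
  qed
  then have "satisfies_identity (G\<lparr>carrier := H\<rparr>) w"
    using satisfies_identity_iff_vanishes_on[OF assms(2) Hs] by blast
  moreover have "\<phi> ` H = H" if "\<phi> \<in> iso G G" for \<phi>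
    using that large_epi_invariant_eq[OF assms(1,2) H(1) _ H(2)] by (simp add: iso_iff_mon_epi)
  then have "characteristic H G"
    using Hs by (simp add: characteristic_def)
  moreover have "surj_endo_invariant H G"
    using Hs H(2) by (simp add: surj_endo_invariant_def)
  ultimately show ?thesis using H(1) by (auto simp: large_def)
qed

end
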